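(* For any graph $G$ and any field $\mathbb{K}$ there exist a finite set $V'$ and abstract simplicial complexes $\Delta'\subset\Delta$ on $V'$ such that for all $k\in\mathbb{Z}_{>0}$ \[ \chi_G(k)=\mathcal{H}_{I_{\Delta/\Delta'}}(k). \]
   Context: A graph is a tuple $(V,E,\mathrm{head},\mathrm{tail})$ with finite vertex set $V$, finite edge set $E$ and maps $\mathrm{head},\mathrm{tail}:E\to V$ (loops and multiple edges allowed); $u\sim v$ means $u,v$ are joined by an edge. A $k$-coloring is a map $x:V\to\{0,\ldots,k-1\}$, proper if $x_u\neq x_v$ whenever $u\sim v$ (so a graph with a loop has no proper colorings). $\chi_G(k)$ is the number of proper $k$-colorings of $G$. For an abstract simplicial complex $\Delta$ on a finite set $V'$, identify $V'$ with the variables of $\mathbb{K}[x]=\mathbb{K}[x_v:v\in V']$ (standard grading). The Stanley–Reisner ideal is $I_\Delta=\langle x^u:\mathrm{supp}(u)\notin\Delta\rangle$, $\mathbb{K}[\Delta]=\mathbb{K}[x]/I_\Delta$, and for a subcomplex $\Delta'\subset\Delta$ the relative Stanley–Reisner ideal $I_{\Delta/\Delta'}$ is the ideal of $\mathbb{K}[\Delta]$ generated by the monomials $x^u$ with $\mathrm{supp}(u)\notin\Delta'$. Its Hilbert function $\mathcal{H}_{I_{\Delta/\Delta'}}(k)$ is the number of monomials $x^u$ of degree $k$ with $\mathrm{supp}(u)\in\Delta\setminus\Delta'$. *)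

theory Defs
  imports
    "HOL-Algebra.Algebra"
    "HOL-Library.FuncSet"
    "HOL-Library.Poly_Mapping"
    "Graph_Theory.Digraph"
begin

definition adjacent :: "('a, 'e) pre_digraph \<Rightarrow> 'a \<Rightarrow> 'a \<Rightarrow> bool" where
  "adjacent G u v \<longleftrightarrow> (\<exists>e\<in>arcs G. {head G e, tail G e} = {u, v})"

definition colorings :: "('a, 'e) pre_digraph \<Rightarrow> nat \<Rightarrow> ('a \<Rightarrow> nat) set" where
  "colorings G k = (verts G \<rightarrow>\<^sub>E {0..<k})"

definition proper_coloring :: "('a, 'e) pre_digraph \<Rightarrow> ('a \<Rightarrow> nat) \<Rightarrow> bool" where
  "proper_coloring G x \<longleftrightarrow> (\<forall>u\<in>verts G. \<forall>v\<in>verts G. adjacent G u v \<longrightarrow> x u \<noteq> x v)"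

definition chromatic :: "('a, 'e) pre_digraph \<Rightarrow> nat \<Rightarrow> nat" where
  "chromatic G k = card {x \<in> colorings G k. proper_coloring G x}"

text \<open>The elements of \<open>V\<close> need not all be vertices of the complex. The void complex is
  excluded, so that the Stanley--Reisner ring is never the zero ring.\<close>

definition simplicial_complex_on :: "'v set \<Rightarrow> 'v set set \<Rightarrow> bool" where
  "simplicial_complex_on V D \<longleftrightarrow>
     D \<subseteq> Pow V \<and> {} \<in> D \<and> (\<forall>S\<in>D. \<forall>T. T \<subseteq> S \<longrightarrow> T \<in> D)"

text \<open>An exponent vector \<open>u\<close> has support \<open>Poly_Mapping.keys u\<close>; a polynomial is a finitely
  supported map from exponent vectors to coefficients.\<close>

type_synonym ('v, 'k) mpoly_rep = "('v \<Rightarrow>\<^sub>0 nat) \<Rightarrow>\<^sub>0 'k"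

definition monomial_degree :: "('v \<Rightarrow>\<^sub>0 nat) \<Rightarrow> nat" where
  "monomial_degree u = (\<Sum>v\<in>Poly_Mapping.keys u. Poly_Mapping.lookup u v)"

definition monom_of :: "('v \<Rightarrow>\<^sub>0 nat) \<Rightarrow> ('v, 'k::field) mpoly_rep" where
  "monom_of u = Poly_Mapping.single u 1"

definition mpoly_ring :: "'v set \<Rightarrow> ('v, 'k::field) mpoly_rep ring" where
  "mpoly_ring V = \<lparr>carrier = {p. \<forall>u\<in>Poly_Mapping.keys p. Poly_Mapping.keys u \<subseteq> V},
     monoid.mult = (*), monoid.one = 1, ring.zero = 0, ring.add = (+)\<rparr>"

definition SR_ideal :: "'v set \<Rightarrow> 'v set set \<Rightarrow> ('v, 'k::field) mpoly_rep set" where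
  "SR_ideal V D = Idl\<^bsub>mpoly_ring V\<^esub>
     {monom_of u | u. Poly_Mapping.keys u \<subseteq> V \<and> Poly_Mapping.keys u \<notin> D}"

definition SR_ring :: "'v set \<Rightarrow> 'v set set \<Rightarrow> ('v, 'k::field) mpoly_rep set ring" where
  "SR_ring V D = mpoly_ring V Quot SR_ideal V D"

definition SR_class ::
    "'v set \<Rightarrow> 'v set set \<Rightarrow> ('v, 'k::field) mpoly_rep \<Rightarrow> ('v, 'k) mpoly_rep set" where
  "SR_class V D p = SR_ideal V D +>\<^bsub>mpoly_ring V\<^esub> p"

definition relative_SR_ideal ::
    "'v set \<Rightarrow> 'v set set \<Rightarrow> 'v set set \<Rightarrow> ('v, 'k::field) mpoly_rep set set" where
  "relative_SR_ideal V D D' = Idl\<^bsub>SR_ring V D\<^esub>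
     {SR_class V D (monom_of u) | u. Poly_Mapping.keys u \<subseteq> V \<and> Poly_Mapping.keys u \<notin> D'}"

text \<open>The copy of the ground field inside the Stanley--Reisner ring.\<close>

definition SR_scalars :: "'v set \<Rightarrow> 'v set set \<Rightarrow> ('v, 'k::field) mpoly_rep set set" where
  "SR_scalars V D = range (\<lambda>c. SR_class V D (Poly_Mapping.single 0 c))"

definition SR_component ::
    "'v set \<Rightarrow> 'v set set \<Rightarrow> nat \<Rightarrow> ('v, 'k::field) mpoly_rep set set" where
  "SR_component V D k = SR_class V D `
     {p \<in> carrier (mpoly_ring V). \<forall>u\<in>Poly_Mapping.keys p. monomial_degree u = k}"

text \<open>The Hilbert function of a homogeneous ideal \<open>J\<close> of the Stanley--Reisner ring of \<open>D\<close>: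
  the dimension over the ground field of the degree \<open>k\<close> part of \<open>J\<close>. For the relative
  Stanley--Reisner ideal, lemma \<open>hilbert_function_relative_SR_ideal\<close> below shows that this is the
  number of monomials of degree \<open>k\<close> whose support lies in \<open>D - D'\<close>.\<close>

definition hilbert_function ::
    "'v set \<Rightarrow> 'v set set \<Rightarrow> ('v, 'k::field) mpoly_rep set set \<Rightarrow> nat \<Rightarrow> nat" where
  "hilbert_function V D J k =
     (ring.dim (SR_ring V D) over SR_scalars V D) (J \<inter> SR_component V D k)"


lemma keys_add_exp:
  "Poly_Mapping.keys (u + v :: 'v \<Rightarrow>\<^sub>0 nat) = Poly_Mapping.keys u \<union> Poly_Mapping.keys v"
  by (auto simp: in_keys_iff lookup_add)

lemma keys_mult_subset:
  fixes p q :: "('v, 'k::field) mpoly_rep"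
  assumes "w \<in> Poly_Mapping.keys (p * q)"
  obtains u v where "u \<in> Poly_Mapping.keys p" "v \<in> Poly_Mapping.keys q" "w = u + v"
  using assms keys_mult[of p q] by blast

lemma mpoly_ring_simps:
  "p \<in> carrier (mpoly_ring V) \<longleftrightarrow> (\<forall>u\<in>Poly_Mapping.keys p. Poly_Mapping.keys u \<subseteq> V)"
  "monoid.mult (mpoly_ring V) p q = p * q"
  "monoid.one (mpoly_ring V) = 1"
  "ring.zero (mpoly_ring V) = 0"
  "ring.add (mpoly_ring V) p q = p + q"
  by (simp_all add: mpoly_ring_def)

lemma cring_mpoly_ring: "cring (mpoly_ring V :: ('v, 'k::field) mpoly_rep ring)"
proof -
  have add: "p + q \<in> carrier (mpoly_ring V)"
    if "p \<in> carrier (mpoly_ring V)" "q \<in> carrier (mpoly_ring V)" for p q :: "('v, 'k) mpoly_rep"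
    using that keys_add[of p q] unfolding mpoly_ring_simps by blast
  have mult: "p * q \<in> carrier (mpoly_ring V)"
    if pq: "p \<in> carrier (mpoly_ring V)" "q \<in> carrier (mpoly_ring V)" for p q :: "('v, 'k) mpoly_rep"
    unfolding mpoly_ring_simps
  proof
    fix w assume "w \<in> Poly_Mapping.keys (p * q)"
    then show "Poly_Mapping.keys w \<subseteq> V"
      by (rule keys_mult_subset) (use pq in \<open>simp add: mpoly_ring_simps keys_add_exp\<close>)
  qed
  have uminus: "- p \<in> carrier (mpoly_ring V)"
    if "p \<in> carrier (mpoly_ring V)" for p :: "('v, 'k) mpoly_rep"
    using that by (simp add: mpoly_ring_simps in_keys_iff)
  show ?thesis
  proof (rule cringI)
    show "abelian_group (mpoly_ring V :: ('v, 'k) mpoly_rep ring)"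
    proof (rule abelian_groupI)
      fix x :: "('v, 'k) mpoly_rep"
      assume "x \<in> carrier (mpoly_ring V)"
      then show "\<exists>y\<in>carrier (mpoly_ring V). y \<oplus>\<^bsub>mpoly_ring V\<^esub> x = \<zero>\<^bsub>mpoly_ring V\<^esub>"
        by (intro bexI[OF _ uminus]) (simp_all add: mpoly_ring_simps)
    qed (simp_all add: mpoly_ring_simps(2-) add, simp_all add: mpoly_ring_simps(1) ac_simps)
    show "Group.comm_monoid (mpoly_ring V :: ('v, 'k) mpoly_rep ring)"
      by (rule comm_monoidI) (simp_all add: mpoly_ring_simps(2-) mult,
          simp_all add: mpoly_ring_simps(1) ac_simps)
  qed (simp add: mpoly_ring_simps(2-) distrib_right)
qed

lemma mpoly_ring_a_minus:
  fixes p q :: "('v, 'k::field) mpoly_rep"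
  assumes "p \<in> carrier (mpoly_ring V)" "q \<in> carrier (mpoly_ring V)"
  shows "p \<ominus>\<^bsub>mpoly_ring V\<^esub> q = p - q"
proof -
  interpret cring "mpoly_ring V :: ('v, 'k) mpoly_rep ring" by (rule cring_mpoly_ring)
  have "- q \<in> carrier (mpoly_ring V)"
    using assms by (auto simp: mpoly_ring_def in_keys_iff)
  then have "\<ominus>\<^bsub>mpoly_ring V\<^esub> q = - q"
    using assms by (intro minus_equality) (auto simp: mpoly_ring_def)
  then show ?thesis by (simp add: a_minus_def mpoly_ring_def)
qed

definition nonface_polys :: "'v set \<Rightarrow> 'v set set \<Rightarrow> ('v, 'k::field) mpoly_rep set" where
  "nonface_polys V D = {p. \<forall>u\<in>Poly_Mapping.keys p. Poly_Mapping.keys u \<subseteq> V \<and> Poly_Mapping.keys u \<notin> D}"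

lemma ideal_nonface_polys:
  assumes "simplicial_complex_on V D"
  shows "ideal (nonface_polys V D) (mpoly_ring V :: ('v, 'k::field) mpoly_rep ring)"
proof -
  interpret cring "mpoly_ring V :: ('v, 'k) mpoly_rep ring" by (rule cring_mpoly_ring)
  have up: "S \<union> T \<notin> D" if "S \<notin> D \<or> T \<notin> D" for S T
    using that assms by (auto simp: simplicial_complex_on_def)
  show ?thesis
  proof (rule idealI)
    show "subgroup (nonface_polys V D) (add_monoid (mpoly_ring V :: ('v, 'k) mpoly_rep ring))"
    proof (rule add.subgroupI)
      fix a :: "('v, 'k) mpoly_rep" assume a: "a \<in> nonface_polys V D"
      then have "\<zero>\<^bsub>mpoly_ring V\<^esub> \<ominus>\<^bsub>mpoly_ring V\<^esub> a = 0 - a"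
        by (subst mpoly_ring_a_minus) (auto simp: mpoly_ring_def nonface_polys_def)
      moreover have "a \<in> carrier (mpoly_ring V)"
        using a by (auto simp: mpoly_ring_def nonface_polys_def)
      ultimately have "\<ominus>\<^bsub>mpoly_ring V\<^esub> a = - a" by (simp add: a_minus_def)
      then show "\<ominus>\<^bsub>mpoly_ring V\<^esub> a \<in> nonface_polys V D"
        using a by (auto simp: nonface_polys_def in_keys_iff)
    next
      fix a b :: "('v, 'k) mpoly_rep"
      assume "a \<in> nonface_polys V D" "b \<in> nonface_polys V D"
      then show "a \<oplus>\<^bsub>mpoly_ring V\<^esub> b \<in> nonface_polys V D"
        using keys_add[of a b] by (fastforce simp: nonface_polys_def mpoly_ring_def)
    next
      show "nonface_polys V D \<noteq> ({} :: ('v, 'k) mpoly_rep set)"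
        by (auto simp: nonface_polys_def intro: exI[of _ 0])
    qed (auto simp: nonface_polys_def mpoly_ring_def)
  next
    fix a x :: "('v, 'k) mpoly_rep"
    assume ax: "a \<in> nonface_polys V D" "x \<in> carrier (mpoly_ring V)"
    have *: "Poly_Mapping.keys w \<subseteq> V \<and> Poly_Mapping.keys w \<notin> D"
      if w: "w \<in> Poly_Mapping.keys (x * a)" for w
    proof -
      obtain u v where "u \<in> Poly_Mapping.keys x" "v \<in> Poly_Mapping.keys a" "w = u + v"
        using keys_mult_subset[OF w] by blast
      then show ?thesis using ax up by (simp add: nonface_polys_def mpoly_ring_def keys_add_exp)
    qed
    then show "x \<otimes>\<^bsub>mpoly_ring V\<^esub> a \<in> nonface_polys V D"
      by (simp add: nonface_polys_def mpoly_ring_def)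
    then show "a \<otimes>\<^bsub>mpoly_ring V\<^esub> x \<in> nonface_polys V D"
      by (simp add: mpoly_ring_def mult.commute)
  qed (rule local.ring_axioms)
qed

lemma poly_sum_monoms:
  "p = (\<Sum>u\<in>Poly_Mapping.keys p. Poly_Mapping.single u (Poly_Mapping.lookup p u))"
  by (rule poly_mapping_eqI)
     (simp add: lookup_sum lookup_single when_def in_keys_iff sum.delta')

lemma nonface_polys_subset:
  assumes I: "ideal I (mpoly_ring V :: ('v, 'k::field) mpoly_rep ring)"
    and mon: "\<And>u. Poly_Mapping.keys u \<subseteq> V \<Longrightarrow> Poly_Mapping.keys u \<notin> D \<Longrightarrow> monom_of u \<in> I"
  shows "nonface_polys V D \<subseteq> I"
proof
  interpret ideal I "mpoly_ring V :: ('v, 'k) mpoly_rep ring" by fact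
  fix p :: "('v, 'k) mpoly_rep" assume p: "p \<in> nonface_polys V D"
  have "(\<Sum>u\<in>A. Poly_Mapping.single u (Poly_Mapping.lookup p u)) \<in> I"
    if "finite A" "A \<subseteq> Poly_Mapping.keys p" for A
    using that
  proof (induction A)
    case empty
    have "\<zero>\<^bsub>mpoly_ring V\<^esub> \<in> I" by (rule additive_subgroup.zero_closed[OF additive_subgroup_axioms])
    then show ?case by (simp add: mpoly_ring_def)
  next
    case (insert u A)
    have "monom_of u \<in> I" using insert.prems p by (intro mon) (auto simp: nonface_polys_def)
    moreover have "Poly_Mapping.single 0 (Poly_Mapping.lookup p u) \<in> carrier (mpoly_ring V)"
      by (auto simp: mpoly_ring_def)
    ultimately have "Poly_Mapping.single 0 (Poly_Mapping.lookup p u) \<otimes>\<^bsub>mpoly_ring V\<^esub> monom_of u \<in> I"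
      by (rule I_l_closed)
    then have "Poly_Mapping.single u (Poly_Mapping.lookup p u) \<in> I"
      by (simp add: mpoly_ring_def monom_of_def mult_single)
    moreover have "(\<Sum>u\<in>A. Poly_Mapping.single u (Poly_Mapping.lookup p u)) \<in> I"
      using insert by auto
    ultimately show ?case
      using additive_subgroup.a_closed[OF additive_subgroup_axioms] insert.hyps
      by (simp add: mpoly_ring_def)
  qed
  from this[of "Poly_Mapping.keys p"] show "p \<in> I" using poly_sum_monoms[of p] by simp
qed

lemma monom_of_nonface:
  assumes "Poly_Mapping.keys u \<subseteq> V" "Poly_Mapping.keys u \<notin> D"
  shows "monom_of u \<in> nonface_polys V D"
  using assms by (auto simp: monom_of_def nonface_polys_def)

lemma nonface_polys_carrier: "nonface_polys V D \<subseteq> carrier (mpoly_ring V)"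
  by (auto simp: nonface_polys_def mpoly_ring_def)

lemma SR_ideal_eq:
  assumes "simplicial_complex_on V D"
  shows "SR_ideal V D = (nonface_polys V D :: ('v, 'k::field) mpoly_rep set)"
proof -
  interpret cring "mpoly_ring V :: ('v, 'k) mpoly_rep ring" by (rule cring_mpoly_ring)
  let ?S = "{monom_of u | u. Poly_Mapping.keys u \<subseteq> V \<and> Poly_Mapping.keys u \<notin> D} :: ('v, 'k) mpoly_rep set"
  have sub: "?S \<subseteq> nonface_polys V D" by (auto intro: monom_of_nonface)
  then have S: "?S \<subseteq> carrier (mpoly_ring V)" using nonface_polys_carrier by blast
  show ?thesis unfolding SR_ideal_def
  proof
    show "Idl\<^bsub>mpoly_ring V\<^esub> ?S \<subseteq> nonface_polys V D"
      by (rule genideal_minimal[OF ideal_nonface_polys[OF assms] sub])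
    show "nonface_polys V D \<subseteq> Idl\<^bsub>mpoly_ring V\<^esub> ?S"
      by (rule nonface_polys_subset[OF genideal_ideal[OF S]])
         (use genideal_self[OF S] in auto)
  qed
qed

context
  fixes V :: "'v set" and D :: "'v set set" and R :: "('v, 'k::field) mpoly_rep ring"
  assumes D: "simplicial_complex_on V D"
  defines "R \<equiv> mpoly_ring V"
begin

lemma ideal_SR: "ideal (SR_ideal V D) R"
  unfolding R_def SR_ideal_eq[OF D] by (rule ideal_nonface_polys[OF D])

lemma SR_hom: "ring_hom_ring R (SR_ring V D) (SR_class V D)"
  using ideal.rcos_ring_hom_ring[OF ideal_SR]
  unfolding SR_ring_def R_def SR_class_def[abs_def] .

lemma cring_SR: "cring (SR_ring V D :: ('v, 'k) mpoly_rep set ring)"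
  using ideal.quotient_is_cring[OF ideal_SR] cring_mpoly_ring
  unfolding SR_ring_def R_def by blast

lemma SR_class_eq_iff:
  assumes "p \<in> carrier R" "q \<in> carrier R"
  shows "SR_class V D p = SR_class V D q \<longleftrightarrow>
    (\<forall>u. Poly_Mapping.keys u \<in> D \<longrightarrow> Poly_Mapping.lookup p u = Poly_Mapping.lookup q u)"
proof -
  interpret ring R using cring_mpoly_ring[of V] unfolding R_def cring_def by blast
  have "SR_class V D p = SR_class V D q \<longleftrightarrow> p - q \<in> SR_ideal V D"
    using quotient_eq_iff_same_a_r_cos[OF ideal_SR assms] mpoly_ring_a_minus[of p V q] assms
    unfolding SR_class_def R_def by auto
  also have "\<dots> \<longleftrightarrow> (\<forall>u. Poly_Mapping.keys u \<in> D \<longrightarrow> Poly_Mapping.lookup p u = Poly_Mapping.lookup q u)"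
  proof -
    have "Poly_Mapping.keys u \<subseteq> V" if "u \<in> Poly_Mapping.keys (p - q)" for u
      using that assms keys_diff[of p q] by (auto simp: R_def mpoly_ring_def)
    then show ?thesis unfolding SR_ideal_eq[OF D] nonface_polys_def
      by (auto simp: in_keys_iff lookup_minus)
  qed
  finally show ?thesis .
qed

lemma SR_carrier: "carrier (SR_ring V D) = SR_class V D ` carrier R"
  unfolding SR_ring_def FactRing_def A_RCOSETS_def' R_def SR_class_def by auto

lemma relative_SR_ideal_eq:
  assumes D': "simplicial_complex_on V D'" and "D' \<subseteq> D"
  shows "relative_SR_ideal V D D' = SR_class V D ` (nonface_polys V D' :: ('v, 'k) mpoly_rep set)"
proof -
  interpret Q: cring "SR_ring V D :: ('v, 'k) mpoly_rep set ring" by (rule cring_SR)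
  interpret h: ring_hom_ring R "SR_ring V D" "SR_class V D" by (rule SR_hom)
  let ?S = "{SR_class V D (monom_of u) | u. Poly_Mapping.keys u \<subseteq> V \<and> Poly_Mapping.keys u \<notin> D'}
     :: ('v, 'k) mpoly_rep set set"
  let ?N = "nonface_polys V D' :: ('v, 'k) mpoly_rep set"
  interpret N: ideal ?N R unfolding R_def by (rule ideal_nonface_polys[OF D'])
  have id: "ideal (SR_class V D ` ?N) (SR_ring V D)"
  proof (rule idealI[OF Q.ring_axioms])
    show "subgroup (SR_class V D ` ?N) (add_monoid (SR_ring V D))"
    proof (rule Q.add.subgroupI)
      fix a assume "a \<in> SR_class V D ` ?N"
      then obtain p where "p \<in> ?N" "a = SR_class V D p" by blast
      then show "\<ominus>\<^bsub>SR_ring V D\<^esub> a \<in> SR_class V D ` ?N"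
        by (metis N.Icarr N.a_inv_closed h.hom_a_inv image_eqI)
    next
      fix a b assume "a \<in> SR_class V D ` ?N" "b \<in> SR_class V D ` ?N"
      then obtain p q where "p \<in> ?N" "a = SR_class V D p" "q \<in> ?N" "b = SR_class V D q" by blast
      then show "a \<oplus>\<^bsub>SR_ring V D\<^esub> b \<in> SR_class V D ` ?N"
        by (metis N.Icarr N.a_closed h.hom_add image_eqI)
    next
      show "SR_class V D ` ?N \<noteq> {}"
        using additive_subgroup.zero_closed[OF N.additive_subgroup_axioms] by blast
    qed (use N.Icarr in auto)
  next
    fix a x :: "('v, 'k) mpoly_rep set"
    assume "a \<in> SR_class V D ` ?N" "x \<in> carrier (SR_ring V D)"
    then obtain p q where pq: "p \<in> ?N" "a = SR_class V D p" "q \<in> carrier R" "x = SR_class V D q"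
      unfolding SR_carrier by blast
    show "x \<otimes>\<^bsub>SR_ring V D\<^esub> a \<in> SR_class V D ` ?N"
      using pq by (metis N.Icarr N.I_l_closed h.hom_mult image_eqI)
    show "a \<otimes>\<^bsub>SR_ring V D\<^esub> x \<in> SR_class V D ` ?N"
      using pq by (metis N.Icarr N.I_r_closed h.hom_mult image_eqI)
  qed
  have sub: "?S \<subseteq> SR_class V D ` ?N" by (auto intro: monom_of_nonface)
  then have S: "?S \<subseteq> carrier (SR_ring V D)" using N.Icarr by force
  show ?thesis unfolding relative_SR_ideal_def
  proof
    show "Idl\<^bsub>SR_ring V D\<^esub> ?S \<subseteq> SR_class V D ` ?N"
      by (rule Q.genideal_minimal[OF id sub])
    let ?P = "{p \<in> carrier R. SR_class V D p \<in> Idl\<^bsub>SR_ring V D\<^esub> ?S}"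
    have "ideal ?P R"
      using h.ideal_vimage[OF Q.genideal_ideal[OF S]] by simp
    then have "?N \<subseteq> ?P" unfolding R_def
    proof (rule nonface_polys_subset)
      fix u :: "'v \<Rightarrow>\<^sub>0 nat" assume u: "Poly_Mapping.keys u \<subseteq> V" "Poly_Mapping.keys u \<notin> D'"
      have "(monom_of u :: ('v, 'k) mpoly_rep) \<in> ?N" by (rule monom_of_nonface[OF u])
      then show "monom_of u \<in> {p \<in> carrier (mpoly_ring V). SR_class V D p \<in> Idl\<^bsub>SR_ring V D\<^esub> ?S}"
        using Q.genideal_self[OF S] u N.Icarr unfolding R_def by blast
    qed
    then show "SR_class V D ` ?N \<subseteq> Idl\<^bsub>SR_ring V D\<^esub> ?S" by auto
  qed
qed

lemma subfield_SR_scalars: "subfield (SR_scalars V D) (SR_ring V D :: ('v, 'k) mpoly_rep set ring)"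
proof -
  interpret R: cring R unfolding R_def by (rule cring_mpoly_ring)
  interpret h: ring_hom_ring R "SR_ring V D" "SR_class V D" by (rule SR_hom)
  let ?C = "range (Poly_Mapping.single 0) :: ('v, 'k) mpoly_rep set"
  have carr: "?C \<subseteq> carrier R" by (auto simp: R_def mpoly_ring_def split: if_splits)
  have "subcring ?C R"
  proof (rule R.subcringI')
    show "subring ?C R"
    proof (rule ring.subringI[OF R.ring_axioms carr])
      fix h assume h: "h \<in> ?C"
      then have "\<zero>\<^bsub>R\<^esub> \<ominus>\<^bsub>R\<^esub> h = 0 - h" unfolding R_def
        by (subst mpoly_ring_a_minus) (auto simp: mpoly_ring_def split: if_splits)
      then have "\<ominus>\<^bsub>R\<^esub> h = - h" using h carr by (auto simp: a_minus_def)
      then show "\<ominus>\<^bsub>R\<^esub> h \<in> ?C" using h by (auto simp: single_uminus[symmetric])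
    qed (auto simp: R_def mpoly_ring_def mult_single single_add[symmetric] image_iff
          intro: exI[of _ 1])
  qed
  moreover have "Units (R \<lparr>carrier := ?C\<rparr>) = ?C - {\<zero>\<^bsub>R\<^esub>}"
  proof (intro equalityI subsetI)
    fix x assume "x \<in> Units (R \<lparr>carrier := ?C\<rparr>)"
    then show "x \<in> ?C - {\<zero>\<^bsub>R\<^esub>}"
      by (auto simp: Units_def R_def mpoly_ring_def)
  next
    fix x assume "x \<in> ?C - {\<zero>\<^bsub>R\<^esub>}"
    then obtain c where x: "x = Poly_Mapping.single 0 c" and "x \<noteq> 0"
      by (auto simp: R_def mpoly_ring_def)
    then have c: "x = Poly_Mapping.single 0 c" "c \<noteq> 0" by auto
    then show "x \<in> Units (R \<lparr>carrier := ?C\<rparr>)"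
      by (auto simp: Units_def R_def mpoly_ring_def mult_single intro!: exI[of _ "inverse c"])
  qed
  ultimately have sf: "subfield ?C R" by (intro R.subfieldI) auto
  have "\<one>\<^bsub>SR_ring V D\<^esub> \<noteq> (\<zero>\<^bsub>SR_ring V D\<^esub> :: ('v, 'k) mpoly_rep set)"
  proof -
    have "SR_class V D \<one>\<^bsub>R\<^esub> \<noteq> SR_class V D \<zero>\<^bsub>R\<^esub>"
      using D by (subst SR_class_eq_iff)
        (auto simp: R_def mpoly_ring_def simplicial_complex_on_def intro!: exI[of _ 0])
    then show ?thesis by simp
  qed
  from h.img_is_subfield(2)[OF sf this] show ?thesis
    by (simp add: SR_scalars_def image_image)
qed

lemma dimension_SR_span:
  assumes "finite M" and "\<And>u. u \<in> M \<Longrightarrow> Poly_Mapping.keys u \<in> D"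
  shows "ring.dimension (SR_ring V D) (card M) (SR_scalars V D)
     (SR_class V D ` {p :: ('v, 'k) mpoly_rep. Poly_Mapping.keys p \<subseteq> M})"
  using assms
proof (induction M)
  case empty
  interpret Q: cring "SR_ring V D :: ('v, 'k) mpoly_rep set ring" by (rule cring_SR)
  interpret h: ring_hom_ring R "SR_ring V D" "SR_class V D" by (rule SR_hom)
  have "{p :: ('v, 'k) mpoly_rep. Poly_Mapping.keys p \<subseteq> {}} = {\<zero>\<^bsub>R\<^esub>}"
    by (auto simp: R_def mpoly_ring_def intro!: poly_mapping_eqI)
  then have "SR_class V D ` {p :: ('v, 'k) mpoly_rep. Poly_Mapping.keys p \<subseteq> {}} = {\<zero>\<^bsub>SR_ring V D\<^esub>}"
    by (simp only: image_insert image_empty h.hom_zero)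
  then show ?case by (simp only: card.empty Q.zero_dim)
next
  case (insert w M)
  interpret Q: cring "SR_ring V D :: ('v, 'k) mpoly_rep set ring" by (rule cring_SR)
  interpret h: ring_hom_ring R "SR_ring V D" "SR_class V D" by (rule SR_hom)
  let ?L = "\<lambda>M. {p :: ('v, 'k) mpoly_rep. Poly_Mapping.keys p \<subseteq> M}"
  have DV: "S \<subseteq> V" if "S \<in> D" for S using D that by (auto simp: simplicial_complex_on_def)
  have wc: "monom_of w \<in> carrier R"
    using insert.prems DV by (auto simp: R_def mpoly_ring_def monom_of_def)
  have Lc: "?L M \<subseteq> carrier R"
  proof
    fix p assume "p \<in> ?L M"
    then have "Poly_Mapping.keys u \<in> D" if "u \<in> Poly_Mapping.keys p" for u
      using insert.prems that by blast
    then show "p \<in> carrier R" using DV unfolding R_def mpoly_ring_simps by blast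
  qed
  have cc: "Poly_Mapping.single 0 c \<in> carrier R" for c
    by (auto simp: R_def mpoly_ring_def split: if_splits)
  have notin: "SR_class V D (monom_of w) \<notin> SR_class V D ` ?L M"
  proof
    assume "SR_class V D (monom_of w) \<in> SR_class V D ` ?L M"
    then obtain p :: "('v, 'k) mpoly_rep" where
      p: "SR_class V D (monom_of w) = SR_class V D p" "Poly_Mapping.keys p \<subseteq> M" by blast
    then have "p \<in> carrier R" using Lc by auto
    with p(1) have "Poly_Mapping.lookup (monom_of w :: ('v, 'k) mpoly_rep) w = Poly_Mapping.lookup p w"
      using SR_class_eq_iff[OF wc] insert.prems by auto
    then have "w \<in> Poly_Mapping.keys p" by (simp add: monom_of_def in_keys_iff)
    with p insert.hyps show False by auto
  qed
  have eq: "SR_class V D (Poly_Mapping.single 0 c) \<otimes>\<^bsub>SR_ring V D\<^esub> SR_class V D (monom_of w)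
      \<oplus>\<^bsub>SR_ring V D\<^esub> SR_class V D p = SR_class V D (Poly_Mapping.single w c + p)"
    if "p \<in> ?L M" for c and p :: "('v, 'k) mpoly_rep"
  proof -
    have "SR_class V D (Poly_Mapping.single 0 c \<otimes>\<^bsub>R\<^esub> monom_of w \<oplus>\<^bsub>R\<^esub> p)
      = SR_class V D (Poly_Mapping.single 0 c) \<otimes>\<^bsub>SR_ring V D\<^esub> SR_class V D (monom_of w)
      \<oplus>\<^bsub>SR_ring V D\<^esub> SR_class V D p"
      using that Lc wc cc[of c] by (simp add: subset_eq)
    moreover have "Poly_Mapping.single 0 c \<otimes>\<^bsub>R\<^esub> monom_of w \<oplus>\<^bsub>R\<^esub> p = Poly_Mapping.single w c + p"
      by (simp add: R_def mpoly_ring_def monom_of_def mult_single)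
    ultimately show ?thesis by simp
  qed
  have "Q.line_extension (SR_scalars V D) (SR_class V D (monom_of w)) (SR_class V D ` ?L M)
      = SR_class V D ` ?L (insert w M)"
  proof (intro equalityI subsetI)
    fix x assume "x \<in> Q.line_extension (SR_scalars V D) (SR_class V D (monom_of w)) (SR_class V D ` ?L M)"
    then obtain c and p :: "('v, 'k) mpoly_rep" where p: "p \<in> ?L M"
      and "x = SR_class V D (Poly_Mapping.single 0 c) \<otimes>\<^bsub>SR_ring V D\<^esub> SR_class V D (monom_of w)
        \<oplus>\<^bsub>SR_ring V D\<^esub> SR_class V D p"
      unfolding Q.line_extension_mem_iff SR_scalars_def by blast
    then have "x = SR_class V D (Poly_Mapping.single w c + p)" using eq[OF p] by simp
    then show "x \<in> SR_class V D ` ?L (insert w M)"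
      using keys_add[of "Poly_Mapping.single w c" p] p by (auto split: if_splits)
  next
    fix x assume "x \<in> SR_class V D ` ?L (insert w M)"
    then obtain p :: "('v, 'k) mpoly_rep" where
      p: "x = SR_class V D p" "Poly_Mapping.keys p \<subseteq> insert w M" by blast
    define c where "c = Poly_Mapping.lookup p w"
    have q: "p - Poly_Mapping.single w c \<in> ?L M"
    proof (intro CollectI subsetI)
      fix u assume "u \<in> Poly_Mapping.keys (p - Poly_Mapping.single w c)"
      then have "Poly_Mapping.lookup p u - Poly_Mapping.lookup (Poly_Mapping.single w c) u \<noteq> 0"
        by (simp add: in_keys_iff lookup_minus)
      then have "u \<noteq> w" "u \<in> Poly_Mapping.keys p"
        by (cases "u = w"; simp add: c_def in_keys_iff lookup_single)+
      with p show "u \<in> M" by blast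
    qed
    from eq[OF q, of c] p have "x = SR_class V D (Poly_Mapping.single 0 c) \<otimes>\<^bsub>SR_ring V D\<^esub>
      SR_class V D (monom_of w) \<oplus>\<^bsub>SR_ring V D\<^esub> SR_class V D (p - Poly_Mapping.single w c)" by simp
    with q show "x \<in> Q.line_extension (SR_scalars V D) (SR_class V D (monom_of w)) (SR_class V D ` ?L M)"
      unfolding Q.line_extension_mem_iff SR_scalars_def by blast
  qed
  moreover have "Q.dimension (Suc (card M)) (SR_scalars V D)
     (Q.line_extension (SR_scalars V D) (SR_class V D (monom_of w)) (SR_class V D ` ?L M))"
    using wc notin insert by (intro Q.Suc_dim) auto
  ultimately show ?case using insert.hyps by simp
qed

end

lemma finite_exponents:
  assumes "finite V"
  shows "finite {u. Poly_Mapping.keys u \<subseteq> V \<and> monomial_degree u = k}"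
proof -
  let ?S = "{u. Poly_Mapping.keys u \<subseteq> V \<and> monomial_degree u = k}"
  have "Poly_Mapping.lookup u v \<le> monomial_degree u" for u :: "'a \<Rightarrow>\<^sub>0 nat" and v
    by (cases "v \<in> Poly_Mapping.keys u")
       (auto simp: monomial_degree_def in_keys_iff intro: member_le_sum)
  then have "Poly_Mapping.lookup ` ?S \<subseteq> {f. \<forall>v. (v \<in> V \<longrightarrow> f v \<in> {..k}) \<and> (v \<notin> V \<longrightarrow> f v = 0)}"
    by (auto simp: in_keys_iff)
  then have "finite (Poly_Mapping.lookup ` ?S)"
    using finite_set_of_finite_funs[OF assms, of "{..k}" 0] finite_subset by blast
  then show ?thesis
    by (rule finite_imageD) (simp add: inj_on_def lookup_inject)
qed

lemma hilbert_function_relative_SR_ideal: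
  assumes "finite V" and D: "simplicial_complex_on V D"
    and D': "simplicial_complex_on V D'" and sub: "D' \<subseteq> D"
  shows "hilbert_function V D (relative_SR_ideal V D D' :: ('v, 'k::field) mpoly_rep set set) k
    = card {u. monomial_degree u = k \<and> Poly_Mapping.keys u \<in> D - D'}"
proof -
  let ?M = "{u. monomial_degree u = k \<and> Poly_Mapping.keys u \<in> D - D'}"
  let ?C = "{p :: ('v, 'k) mpoly_rep. Poly_Mapping.keys p \<subseteq> ?M}"
  interpret Q: cring "SR_ring V D :: ('v, 'k) mpoly_rep set ring" by (rule cring_SR[OF D])
  have DV: "S \<subseteq> V" if "S \<in> D" for S using D that by (auto simp: simplicial_complex_on_def)
  have fin: "finite ?M"
    by (rule finite_subset[OF _ finite_exponents[OF assms(1), of k]]) (use DV in auto)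
  have "relative_SR_ideal V D D' \<inter> SR_component V D k = SR_class V D ` ?C"
  proof (intro equalityI subsetI)
    fix x :: "('v, 'k) mpoly_rep set"
    assume "x \<in> relative_SR_ideal V D D' \<inter> SR_component V D k"
    then obtain p q where p: "p \<in> nonface_polys V D'" "x = SR_class V D p"
      and q: "q \<in> carrier (mpoly_ring V)" "\<forall>u\<in>Poly_Mapping.keys q. monomial_degree u = k"
        "x = SR_class V D q"
      unfolding relative_SR_ideal_eq[OF D D' sub] SR_component_def by blast
    have eq: "Poly_Mapping.lookup p u = Poly_Mapping.lookup q u" if "Poly_Mapping.keys u \<in> D" for u
      using SR_class_eq_iff[OF D, of p q] p q nonface_polys_carrier that by blast
    define r where "r = Poly_Mapping.mapp (\<lambda>u c. c when u \<in> ?M) q"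
    have r: "Poly_Mapping.lookup r u = (Poly_Mapping.lookup q u when u \<in> ?M)" for u
      by (simp add: r_def lookup_mapp when_def in_keys_iff)
    have rC: "r \<in> ?C" by (auto simp: in_keys_iff r)
    then have "r \<in> carrier (mpoly_ring V)" using DV by (auto simp: mpoly_ring_def)
    moreover have "Poly_Mapping.lookup q u = Poly_Mapping.lookup r u" if u: "Poly_Mapping.keys u \<in> D" for u
    proof (cases "u \<in> Poly_Mapping.keys q")
      case True
      then have "u \<in> Poly_Mapping.keys p" using eq[OF u] by (simp add: in_keys_iff)
      then have "u \<in> ?M" using p(1) q(2) True u by (auto simp: nonface_polys_def)
      then show ?thesis by (simp add: r)
    next
      case False
      then show ?thesis by (simp add: r in_keys_iff)
    qed
    ultimately have "x = SR_class V D r" using SR_class_eq_iff[OF D, of q r] q by blast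
    then show "x \<in> SR_class V D ` ?C" using rC by blast
  next
    fix x :: "('v, 'k) mpoly_rep set"
    assume "x \<in> SR_class V D ` ?C"
    then obtain p where p: "p \<in> ?C" "x = SR_class V D p" by blast
    then have "p \<in> nonface_polys V D'" using DV by (auto simp: nonface_polys_def)
    then show "x \<in> relative_SR_ideal V D D' \<inter> SR_component V D k"
      using p nonface_polys_carrier unfolding relative_SR_ideal_eq[OF D D' sub] SR_component_def by blast
  qed
  moreover have "Q.dimension (card ?M) (SR_scalars V D) (SR_class V D ` ?C)"
    by (rule dimension_SR_span[OF D fin]) auto
  ultimately show ?thesis
    unfolding hilbert_function_def by (simp only: Q.dimI[OF subfield_SR_scalars[OF D]])
qed

end

theory Submission
  imports Defs
begin

text \<open>A \<open>k\<close>-coloring \<open>x\<close> is encoded by the multichain \<open>S\<^sub>0 \<subseteq> \<dots> \<subseteq> S\<^bsub>k-1\<^esub>\<close> of vertex sets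
  \<open>S\<^sub>t = {v. x v < t}\<close>, that is, by a monomial of degree \<open>k\<close> in variables indexed by vertex sets,
  whose support is a chain containing \<open>S\<^sub>0 = {}\<close>. Every such monomial arises exactly once. The
  coloring is proper iff every edge is separated by a member of the chain, and both this condition
  and containing \<open>{}\<close> are inherited by larger chains. So the proper colorings correspond to the
  monomials supported on \<open>\<Delta> - \<Delta>'\<close>, where \<open>\<Delta>\<close> is the order complex of the Boolean lattice and
  \<open>\<Delta>'\<close> consists of the chains violating one of the two conditions.\<close>

section \<open>Colorings as multichains of vertex sets\<close>

definition lower_set :: "'a set \<Rightarrow> ('a \<Rightarrow> nat) \<Rightarrow> nat \<Rightarrow> 'a set" where
  "lower_set V x t = {v \<in> V. x v < t}"

text \<open>The map \<open>e\<close> names the variable of each vertex set, so that any type with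
  enough elements can supply the variables. A set repeated in the multichain raises its
  exponent.\<close>

definition coloring_monomial :: "'a set \<Rightarrow> ('a set \<Rightarrow> 'v) \<Rightarrow> nat \<Rightarrow> ('a \<Rightarrow> nat) \<Rightarrow> 'v \<Rightarrow>\<^sub>0 nat" where
  "coloring_monomial V e k x = (\<Sum>t<k. Poly_Mapping.single (e (lower_set V x t)) 1)"

definition set_chains :: "'a set \<Rightarrow> 'a set set set" where
  "set_chains V = {K. K \<subseteq> Pow V \<and> chain\<^sub>\<subseteq> K}"

text \<open>A loop at a vertex \<open>u\<close> yields the pair \<open>u\<close>, \<open>u\<close>,
  which no set separates. Then no chain is separating and \<Delta>' = \<Delta>, in accord with the
  absence of proper colorings.\<close>

definition separating :: "('a, 'e) pre_digraph \<Rightarrow> 'a set set \<Rightarrow> bool" where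
  "separating G K \<longleftrightarrow>
     (\<forall>u\<in>verts G. \<forall>v\<in>verts G. adjacent G u v \<longrightarrow> (\<exists>S\<in>K. (u \<in> S) \<noteq> (v \<in> S)))"

lemma separating_mono: "separating G K \<Longrightarrow> K \<subseteq> L \<Longrightarrow> separating G L"
  unfolding separating_def by (meson subsetD)

lemma set_chains_subset: "K \<in> set_chains V \<Longrightarrow> L \<subseteq> K \<Longrightarrow> L \<in> set_chains V"
  unfolding set_chains_def chain_subset_def by blast

lemma simplicial_complex_on_image:
  assumes "\<K> \<subseteq> Pow (Pow V)" "{} \<in> \<K>" and sub: "\<And>K L. K \<in> \<K> \<Longrightarrow> L \<subseteq> K \<Longrightarrow> L \<in> \<K>"
  shows "simplicial_complex_on (e ` Pow V) (image e ` \<K>)"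
  unfolding simplicial_complex_on_def
proof (intro conjI ballI allI impI)
  show "image e ` \<K> \<subseteq> Pow (e ` Pow V)" using assms(1) by blast
  show "{} \<in> image e ` \<K>" using assms(2) by blast
  fix S T assume "S \<in> image e ` \<K>" "T \<subseteq> S"
  then show "T \<in> image e ` \<K>" using sub by (auto elim!: subset_imageE)
qed

lemma lower_set_Pow: "lower_set V x t \<in> Pow V"
  by (auto simp: lower_set_def)

lemma lower_set_mono: "s \<le> t \<Longrightarrow> lower_set V x s \<subseteq> lower_set V x t"
  by (auto simp: lower_set_def)

lemma chain_lower_sets: "lower_set V x ` {..<k} \<in> set_chains V"
proof -
  have "lower_set V x s \<subseteq> lower_set V x t \<or> lower_set V x t \<subseteq> lower_set V x s" for s t
    using linear[of s t] lower_set_mono[of s t V x] lower_set_mono[of t s V x] by argo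
  moreover have "lower_set V x ` {..<k} \<subseteq> Pow V"
    by (intro image_subsetI lower_set_Pow)
  ultimately show ?thesis
    by (simp add: set_chains_def chain_subset_def)
qed

lemma separating_lower_sets:
  assumes "x \<in> colorings G k"
  shows "separating G (lower_set (verts G) x ` {..<k}) \<longleftrightarrow> proper_coloring G x"
proof -
  have sep: "(\<exists>S\<in>lower_set (verts G) x ` {..<k}. (u \<in> S) \<noteq> (v \<in> S)) \<longleftrightarrow> x u \<noteq> x v"
    if uv: "u \<in> verts G" "v \<in> verts G" for u v
  proof
    assume "x u \<noteq> x v"
    moreover have "x u < k" "x v < k" using assms uv by (auto simp: colorings_def PiE_iff)
    ultimately show "\<exists>S\<in>lower_set (verts G) x ` {..<k}. (u \<in> S) \<noteq> (v \<in> S)"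
      \<comment> \<open>At the larger of the two colors taken as threshold, only the vertex of
        smaller color lies in the lower set. This threshold is below \<open>k\<close>, so the
        \<open>k\<close> sets of the multichain suffice.\<close>
      using uv by (intro bexI[of _ "lower_set (verts G) x (max (x u) (x v))"])
        (auto simp: lower_set_def)
  qed (use uv in \<open>auto simp: lower_set_def\<close>)
  show ?thesis
    unfolding separating_def proper_coloring_def by (simp only: sep cong: ball_cong)
qed

section \<open>Bijection between colorings and monomials\<close>

context
  fixes V :: "'a set" and e :: "'a set \<Rightarrow> 'v"
  assumes finV: "finite V" and inj: "inj_on e (Pow V)"
begin

lemma lookup_coloring_monomial:
  assumes "S \<subseteq> V"
  shows "Poly_Mapping.lookup (coloring_monomial V e k x) (e S) = card {t. t < k \<and> lower_set V x t = S}"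
proof -
  have eq: "e (lower_set V x t) = e S \<longleftrightarrow> lower_set V x t = S" for t
    using assms by (intro inj_on_eq_iff[OF inj] lower_set_Pow PowI)
  have "{t. t < k \<and> lower_set V x t = S} = {t\<in>{..<k}. lower_set V x t = S}" by auto
  then show ?thesis
    by (simp only: card_eq_sum sum.inter_filter[OF finite_lessThan])
       (simp add: coloring_monomial_def lookup_sum lookup_single when_def eq del: One_nat_def)
qed

lemma keys_coloring_monomial:
  "Poly_Mapping.keys (coloring_monomial V e k x) = e ` lower_set V x ` {..<k}"
proof (rule Set.set_eqI)
  fix i
  have "i \<in> Poly_Mapping.keys (coloring_monomial V e k x) \<longleftrightarrow> (\<exists>t<k. e (lower_set V x t) = i)"
    by (auto simp: coloring_monomial_def in_keys_iff lookup_sum lookup_single when_def split: if_splits)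
  then show "i \<in> Poly_Mapping.keys (coloring_monomial V e k x) \<longleftrightarrow> i \<in> e ` lower_set V x ` {..<k}"
    by (simp only: image_image image_iff Bex_def lessThan_iff eq_commute[of i])
qed

lemma monomial_degree_eq:
  assumes "Poly_Mapping.keys u \<subseteq> e ` Pow V"
  shows "monomial_degree u = (\<Sum>S\<in>Pow V. Poly_Mapping.lookup u (e S))"
proof -
  have "monomial_degree u = (\<Sum>i\<in>e ` Pow V. Poly_Mapping.lookup u i)"
    unfolding monomial_degree_def
    using assms finV by (intro sum.mono_neutral_left) (auto simp: in_keys_iff)
  then show ?thesis using inj by (simp add: sum.reindex)
qed

text \<open>Used for two families: all of \<open>Pow V\<close> gives the degree, and the sets
  omitting a vertex give its color.\<close>

lemma sum_lookup_coloring_monomial: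
  assumes "\<S> \<subseteq> Pow V"
  shows "(\<Sum>S\<in>\<S>. Poly_Mapping.lookup (coloring_monomial V e k x) (e S)) =
    card {t. t < k \<and> lower_set V x t \<in> \<S>}"
proof -
  have "(\<Sum>S\<in>\<S>. Poly_Mapping.lookup (coloring_monomial V e k x) (e S)) =
      (\<Sum>S\<in>\<S>. card {t. t < k \<and> lower_set V x t = S})"
    using assms by (intro sum.cong lookup_coloring_monomial) auto
  also have "\<dots> = card (\<Union>S\<in>\<S>. {t. t < k \<and> lower_set V x t = S})"
    using assms finV finite_subset[OF assms] by (subst card_UN_disjoint) auto
  also have "(\<Union>S\<in>\<S>. {t. t < k \<and> lower_set V x t = S}) = {t. t < k \<and> lower_set V x t \<in> \<S>}" by auto
  finally show ?thesis .
qed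

lemma monomial_degree_coloring_monomial: "monomial_degree (coloring_monomial V e k x) = k"
proof -
  have "Poly_Mapping.keys (coloring_monomial V e k x) \<subseteq> e ` Pow V"
    unfolding keys_coloring_monomial by (intro image_mono image_subsetI lower_set_Pow)
  then have "monomial_degree (coloring_monomial V e k x) = card {t. t < k \<and> lower_set V x t \<in> Pow V}"
    by (simp only: monomial_degree_eq sum_lookup_coloring_monomial[OF subset_refl])
  then show ?thesis by (simp only: lower_set_Pow) simp
qed

lemma inj_on_coloring_monomial: "inj_on (coloring_monomial V e k) (V \<rightarrow>\<^sub>E {0..<k})"
proof (rule inj_onI)
  fix x y assume x: "x \<in> V \<rightarrow>\<^sub>E {0..<k}" and y: "y \<in> V \<rightarrow>\<^sub>E {0..<k}"
    and eq: "coloring_monomial V e k x = coloring_monomial V e k y"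
  \<comment> \<open>The color of \<open>v\<close> can be read off the exponents: the sets of the
    multichain omitting \<open>v\<close> are those at positions 0 to \<open>z v\<close>, hence the
    \<open>Suc\<close>.\<close>
  have *: "(\<Sum>S | S \<subseteq> V \<and> v \<notin> S. Poly_Mapping.lookup (coloring_monomial V e k z) (e S)) = Suc (z v)"
    if "z \<in> V \<rightarrow>\<^sub>E {0..<k}" "v \<in> V" for z v
  proof -
    have "z v < k" using that by auto
    then have "{t. t < k \<and> lower_set V z t \<in> {S. S \<subseteq> V \<and> v \<notin> S}} = {..z v}"
      using that(2) by (auto simp: lower_set_def)
    then show ?thesis by (subst sum_lookup_coloring_monomial) auto
  qed
  show "x = y" using x y
  proof (rule PiE_ext)
    fix v assume "v \<in> V"
    then show "x v = y v" using *[OF x] *[OF y] eq by simp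
  qed
qed

text \<open>Injectivity dictates the preimage: the color of \<open>v\<close> must be one less than
  the number of members of the multichain, with multiplicity, that omit \<open>v\<close>. This
  number lies between 1, because \<open>{}\<close> occurs, and \<open>k\<close>.\<close>

lemma coloring_monomial_surj:
  assumes K: "K \<in> set_chains V" "{} \<in> K" and u: "Poly_Mapping.keys u = e ` K" "monomial_degree u = k"
  obtains x where "x \<in> V \<rightarrow>\<^sub>E {0..<k}" "coloring_monomial V e k x = u"
proof -
  let ?u = "\<lambda>S. Poly_Mapping.lookup u (e S)"
  define w where "w v = (\<Sum>S | S \<in> K \<and> v \<notin> S. ?u S)" for v
  define x where "x = (\<lambda>v\<in>V. w v - 1)"
  have KV: "K \<subseteq> Pow V" using K by (simp add: set_chains_def)
  then have finK: "finite K" using finV by (simp add: finite_subset)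
  have deg: "(\<Sum>S\<in>Pow V. ?u S) = k"
    using monomial_degree_eq[of u] u image_mono[OF KV, of e] by simp
  have out: "?u S = 0" if "S \<in> Pow V - K" for S
    using that KV u(1) inj_on_image_mem_iff[OF inj, of S K] by (auto simp: in_keys_iff)
  have degK: "(\<Sum>S\<in>K. ?u S) = k"
    unfolding deg[symmetric] using KV finV out by (intro sum.mono_neutral_left) auto
  have w_pos: "w v > 0" for v
  proof -
    have "?u {} > 0" using K u by (metis gr0I image_eqI in_keys_iff)
    then show ?thesis
      unfolding w_def using K finK by (intro sum_pos2[of _ "{}"]) auto
  qed
  have w_le: "w v \<le> k" for v
    unfolding w_def degK[symmetric] using finK by (intro sum_mono2) auto
  \<comment> \<open>Positivity of \<open>w v\<close> keeps the subtraction in \<open>x\<close> from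
    truncating.\<close>
  have x_less: "x v < t \<longleftrightarrow> w v \<le> t" if "v \<in> V" for v t
    using w_pos[of v] that by (auto simp: x_def)
  have x: "x \<in> V \<rightarrow>\<^sub>E {0..<k}"
    using x_less w_le by (auto simp: x_def)
  \<comment> \<open>One inequality per set is enough: both families of exponents sum to
    \<open>k\<close>, so it must be an equality everywhere.\<close>
  have le: "?u T \<le> Poly_Mapping.lookup (coloring_monomial V e k x) (e T)" if T: "T \<in> Pow V" for T
  proof (cases "T \<in> K")
    case True
    txt \<open>\<open>T\<close> occupies the positions \<open>?a, \<dots>, ?a + ?u T - 1\<close> of the sorted multichain.\<close>
    let ?a = "\<Sum>S | S \<in> K \<and> S \<subset> T. ?u S"
    have sum_a: "?a + ?u T = (\<Sum>S | S \<in> K \<and> S \<subseteq> T. ?u S)"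
    proof -
      have "{S. S \<in> K \<and> S \<subseteq> T} = insert T {S. S \<in> K \<and> S \<subset> T}" using True by auto
      then show ?thesis using finK by simp
    qed
    have ak: "?a + ?u T \<le> k"
      unfolding sum_a degK[symmetric] using finK by (intro sum_mono2) auto
    have "lower_set V x t = T" if t: "?a \<le> t" "t < ?a + ?u T" for t
    proof -
      have "x v < t \<longleftrightarrow> v \<in> T" if v: "v \<in> V" for v
      proof (cases "v \<in> T")
        case True
        \<comment> \<open>In a chain, a member omitting some point of \<open>T\<close> cannot
          contain \<open>T\<close>, so it lies strictly below \<open>T\<close>.\<close>
        have "{S. S \<in> K \<and> v \<notin> S} \<subseteq> {S. S \<in> K \<and> S \<subset> T}"
          using True \<open>T \<in> K\<close> K(1) unfolding set_chains_def chain_subset_def by blast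
        then have "w v \<le> ?a"
          unfolding w_def using finK by (intro sum_mono2) auto
        then show ?thesis using x_less[OF v] t True by simp
      next
        case False
        \<comment> \<open>Conversely, if \<open>v\<close> is outside \<open>T\<close>, every member
          up to and including \<open>T\<close> omits \<open>v\<close>.\<close>
        have "?a + ?u T \<le> w v"
          unfolding sum_a w_def using finK False by (intro sum_mono2) auto
        then show ?thesis using x_less[OF v] t False by simp
      qed
      then show ?thesis using T by (auto simp: lower_set_def)
    qed
    then have "{?a..<?a + ?u T} \<subseteq> {t. t < k \<and> lower_set V x t = T}" using ak by auto
    then have "card {?a..<?a + ?u T} \<le> card {t. t < k \<and> lower_set V x t = T}"
      by (intro card_mono) auto
    then show ?thesis using T by (simp add: lookup_coloring_monomial)
  next
    case False
    then show ?thesis using out T by simp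
  qed
  have keys: "Poly_Mapping.keys (coloring_monomial V e k x) \<subseteq> e ` Pow V"
    unfolding keys_coloring_monomial by (intro image_mono image_subsetI lower_set_Pow)
  have sums: "(\<Sum>S\<in>Pow V. ?u S) =
      (\<Sum>S\<in>Pow V. Poly_Mapping.lookup (coloring_monomial V e k x) (e S))"
    using deg monomial_degree_eq[OF keys] monomial_degree_coloring_monomial by simp
  have "coloring_monomial V e k x = u"
  proof (rule poly_mapping_eqI)
    fix i
    show "Poly_Mapping.lookup (coloring_monomial V e k x) i = Poly_Mapping.lookup u i"
    proof (cases "i \<in> e ` Pow V")
      case True
      then obtain S where "S \<in> Pow V" "i = e S" by blast
      then show ?thesis using sum_mono_inv[OF sums le] finV by simp
    next
      case False
      then show ?thesis using keys u(1) KV by (metis image_mono in_keys_iff subsetD)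
    qed
  qed
  with x that show ?thesis by blast
qed

end

section \<open>Proper colorings and the relative complex\<close>

lemma chromatic_eq_card_monomials:
  assumes fin: "finite (verts G)" and inj: "inj_on e (Pow (verts G))" and k: "k > 0"
  shows "chromatic G k = card {u. monomial_degree u = k \<and>
    Poly_Mapping.keys u \<in> image e ` {K \<in> set_chains (verts G). {} \<in> K \<and> separating G K}}"
    (is "_ = card ?M")
proof -
  let ?V = "verts G"
  let ?X = "{x \<in> colorings G k. proper_coloring G x}"
  let ?f = "coloring_monomial ?V e k"
  have "inj_on ?f ?X"
    using inj_on_coloring_monomial[OF fin inj, of k]
    by (rule inj_on_subset) (auto simp: colorings_def)
  moreover have "?f ` ?X = ?M"
  proof (intro equalityI subsetI)
    fix u assume "u \<in> ?f ` ?X"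
    then obtain x where x: "x \<in> colorings G k" "proper_coloring G x" "u = ?f x" by blast
    \<comment> \<open>Positivity of \<open>k\<close> enters here: it provides the position 0, whose
      lower set is empty.\<close>
    have "{} \<in> lower_set ?V x ` {..<k}"
      using k by (intro image_eqI[of _ _ 0]) (auto simp: lower_set_def)
    then have "lower_set ?V x ` {..<k} \<in> {K \<in> set_chains ?V. {} \<in> K \<and> separating G K}"
      using x separating_lower_sets[of x G k] chain_lower_sets by blast
    then show "u \<in> ?M"
      using x keys_coloring_monomial[OF fin inj] monomial_degree_coloring_monomial[OF fin inj]
      by blast
  next
    fix u assume "u \<in> ?M"
    then obtain K where K: "K \<in> set_chains ?V" "{} \<in> K" "separating G K"
      and u: "Poly_Mapping.keys u = e ` K" "monomial_degree u = k" by blast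
    obtain x where x: "x \<in> ?V \<rightarrow>\<^sub>E {0..<k}" "?f x = u"
      using coloring_monomial_surj[OF fin inj K(1,2) u] by blast
    have "e ` lower_set ?V x ` {..<k} = e ` K"
      using keys_coloring_monomial[OF fin inj] x u by metis
    moreover have "lower_set ?V x ` {..<k} \<subseteq> Pow ?V" "K \<subseteq> Pow ?V"
      using chain_lower_sets K(1) by (auto simp: set_chains_def lower_set_def)
    ultimately have "lower_set ?V x ` {..<k} = K"
      using inj_on_image_eq_iff[OF inj] by simp
    then have "x \<in> ?X"
      using separating_lower_sets[of x G k] x K by (simp add: colorings_def)
    then show "u \<in> ?f ` ?X" using x by blast
  qed
  ultimately show ?thesis
    unfolding chromatic_def using card_image[of ?f ?X] by argo
qed

theorem theorem11:
  fixes G :: "('a, 'e) pre_digraph"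
  assumes "fin_digraph G"
  shows "\<exists>(V :: nat set) \<Delta> \<Delta>'. finite V \<and> simplicial_complex_on V \<Delta> \<and>
     simplicial_complex_on V \<Delta>' \<and> \<Delta>' \<subseteq> \<Delta> \<and>
     (\<forall>k>0. chromatic G k =
        hilbert_function V \<Delta> (relative_SR_ideal V \<Delta> \<Delta>' :: (nat, 'k::field) mpoly_rep set set) k)"
proof -
  let ?V = "verts G"
  have fin: "finite ?V" using assms by (rule fin_digraph.finite_verts)
  \<comment> \<open>The complexes have to live on natural numbers, so the finitely many vertex sets
    are numbered.\<close>
  then obtain e :: "'a set \<Rightarrow> nat" where inj: "inj_on e (Pow ?V)"
    using finite_imp_inj_to_nat_seg[of "Pow ?V"] by blast
  let ?\<K> = "set_chains ?V"
  let ?\<K>' = "{K \<in> set_chains ?V. \<not> ({} \<in> K \<and> separating G K)}"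
  let ?W = "e ` Pow ?V"
  let ?\<Delta> = "image e ` ?\<K>"
  let ?\<Delta>' = "image e ` ?\<K>'"
  have Pow: "?\<K> \<subseteq> Pow (Pow ?V)" and empty: "{} \<in> ?\<K>"
    by (auto simp: set_chains_def chain_subset_def)
  have \<Delta>: "simplicial_complex_on ?W ?\<Delta>"
    using Pow empty set_chains_subset by (rule simplicial_complex_on_image)
  have \<Delta>': "simplicial_complex_on ?W ?\<Delta>'"
  proof (rule simplicial_complex_on_image)
    fix K L assume "K \<in> ?\<K>'" "L \<subseteq> K"
    \<comment> \<open>A violated condition stays violated on a subchain, since both conditions pass
      to larger chains.\<close>
    then show "L \<in> ?\<K>'" using set_chains_subset separating_mono by blast
  qed (use Pow empty in auto)
  have diff: "?\<Delta> - ?\<Delta>' = image e ` {K \<in> ?\<K>. {} \<in> K \<and> separating G K}"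
  proof -
    have "?\<Delta> - ?\<Delta>' = image e ` (?\<K> - ?\<K>')"
      \<comment> \<open>Taking images under \<open>e\<close> is injective on sets of vertex sets, so
        it commutes with set difference.\<close>
      using Pow by (intro inj_on_image_set_diff[OF inj_on_image_Pow[OF inj], symmetric]) auto
    also have "?\<K> - ?\<K>' = {K \<in> ?\<K>. {} \<in> K \<and> separating G K}" by blast
    finally show ?thesis .
  qed
  have sub: "?\<Delta>' \<subseteq> ?\<Delta>" by blast
  have finW: "finite ?W" using fin by simp
  have "chromatic G k =
      hilbert_function ?W ?\<Delta> (relative_SR_ideal ?W ?\<Delta> ?\<Delta>' :: (nat, 'k) mpoly_rep set set) k"
    if "k > 0" for k
    unfolding hilbert_function_relative_SR_ideal[OF finW \<Delta> \<Delta>' sub] diff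
    using fin inj that by (rule chromatic_eq_card_monomials)
  then show ?thesis using finW \<Delta> \<Delta>' sub by blast
qed

end
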